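(* Let $a,b\in\mathbb{C}$, write $z=x+iy$, $s=z\bar z=|z|^2$, and let $F_3(s)=s^3+144s^2+5760s+92160$. Define $$\begin{aligned}W_{a,b}={}&z^3F_3(s)-\tfrac14\bar a z^6-\tfrac54a\,(s^3+72s^2+1152s-9216)-b(s+24)\bar z^2\\&+\tfrac14\bar a b z+\tfrac5{16}a\bar a z^3-\tfrac5{16}a^2\bar z^3+\tfrac5{64}a^2\bar a,\end{aligned}$$ $$\begin{aligned}P_{a,b}={}&19568944742400+4892236185600|z|^2+611529523200|z^2|^2+50960793600|z|^6+398131200|a|^2\\&+2919628800\left|z^4-\tfrac1{22}az\right|^2+\tfrac{298598400}{11}|az|^2\\&+114130944\left|z^5-\tfrac{25}{172}az^2-\tfrac1{86}b\right|^2+\tfrac{74649600}{43}\left|az^2-\tfrac19b\right|^2\\&+2820096\left|z^6-\tfrac{35}{102}az^3-\tfrac5{816}a^2-\tfrac8{153}bz\right|^2+\tfrac{230400}{17}\left|az^3-\tfrac7{16}a^2-\tfrac13bz\right|^2\\&+41472\left|z^7-\tfrac58az^4-\tfrac16bz^2\right|^2+324\left|z^8-az^5-\tfrac49bz^3+\tfrac1{36}ab\right|^2\\&+\left|z^9-\tfrac32az^6+\tfrac5{64}a^3-bz^4+\tfrac14abz\right|^2 .\end{aligned}$$ Then $P_{a,b}$ is a positive polynomial and, for every $a,b\in\mathbb{C}$, the function $$\Psi_{3,a,b}(z)=\frac{W_{a,b}(z,\bar z)}{\sqrt{P_{a,b}(z,\bar z)}}$$ is a smooth solution on $\mathbb{R}^2$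 of the complex sine-Gordon II equation $$\Delta\psi+\frac{(\nabla\psi)^2\bar\psi}{2-|\psi|^2}+\frac12\psi(1-|\psi|^2)(2-|\psi|^2)=0 .$$
   Context: Here $\psi:\mathbb{R}^2\to\mathbb{C}$ and $(\nabla\psi)^2=(\partial_x\psi)^2+(\partial_y\psi)^2$ (no complex conjugation). *)

theory Defs
  imports "HOL-Analysis.Analysis"
begin

definition partial_x :: "(real \<times> real \<Rightarrow> complex) \<Rightarrow> real \<times> real \<Rightarrow> complex" where
  "partial_x f = (\<lambda>(x, y). vector_derivative (\<lambda>t. f (t, y)) (at x))"

definition partial_y :: "(real \<times> real \<Rightarrow> complex) \<Rightarrow> real \<times> real \<Rightarrow> complex" where
  "partial_y f = (\<lambda>(x, y). vector_derivative (\<lambda>t. f (x, t)) (at y))"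

definition has_partials :: "(real \<times> real \<Rightarrow> complex) \<Rightarrow> bool" where
  "has_partials f \<longleftrightarrow>
     (\<forall>x y. (\<lambda>t. f (t, y)) differentiable (at x) \<and> (\<lambda>t. f (x, t)) differentiable (at y))"

(* class C^k on the whole plane *)
primrec Ck_plane :: "nat \<Rightarrow> (real \<times> real \<Rightarrow> complex) \<Rightarrow> bool" where
  "Ck_plane 0 f \<longleftrightarrow> continuous_on UNIV f"
| "Ck_plane (Suc k) f \<longleftrightarrow>
     continuous_on UNIV f \<and> has_partials f \<and> Ck_plane k (partial_x f) \<and> Ck_plane k (partial_y f)"

definition smooth_plane :: "(real \<times> real \<Rightarrow> complex) \<Rightarrow> bool" where
  "smooth_plane f \<longleftrightarrow> (\<forall>k. Ck_plane k f)"

definition laplacian :: "(real \<times> real \<Rightarrow> complex) \<Rightarrow> real \<times> real \<Rightarrow> complex" where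
  "laplacian f p = partial_x (partial_x f) p + partial_y (partial_y f) p"

(* no complex conjugation: this is not the squared norm of the gradient *)
definition grad_sq :: "(real \<times> real \<Rightarrow> complex) \<Rightarrow> real \<times> real \<Rightarrow> complex" where
  "grad_sq f p = (partial_x f p)\<^sup>2 + (partial_y f p)\<^sup>2"

(* The condition |psi|^2 \<noteq> 2 says that the quotient in the equation is defined; it is
   needed because division by zero is total in HOL. *)
definition CSG2_equation_at :: "(real \<times> real \<Rightarrow> complex) \<Rightarrow> real \<times> real \<Rightarrow> bool" where
  "CSG2_equation_at \<psi> p \<longleftrightarrow>
     (cmod (\<psi> p))\<^sup>2 \<noteq> 2 \<and>
     laplacian \<psi> p
       + grad_sq \<psi> p * cnj (\<psi> p) / complex_of_real (2 - (cmod (\<psi> p))\<^sup>2)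
       + 1 / 2 * \<psi> p * complex_of_real (1 - (cmod (\<psi> p))\<^sup>2)
           * complex_of_real (2 - (cmod (\<psi> p))\<^sup>2) = 0"

definition smooth_CSG2_solution :: "(real \<times> real \<Rightarrow> complex) \<Rightarrow> bool" where
  "smooth_CSG2_solution \<psi> \<longleftrightarrow> smooth_plane \<psi> \<and> (\<forall>p. CSG2_equation_at \<psi> p)"

definition F3 :: "complex \<Rightarrow> complex" where
  "F3 s = s ^ 3 + 144 * s ^ 2 + 5760 * s + 92160"

definition W3 :: "complex \<Rightarrow> complex \<Rightarrow> complex \<Rightarrow> complex" where
  "W3 a b z = (let s = z * cnj z in
     z ^ 3 * F3 s - 1 / 4 * cnj a * z ^ 6
     - 5 / 4 * a * (s ^ 3 + 72 * s ^ 2 + 1152 * s - 9216)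
     - b * (s + 24) * (cnj z) ^ 2
     + 1 / 4 * cnj a * b * z + 5 / 16 * a * cnj a * z ^ 3
     - 5 / 16 * a ^ 2 * (cnj z) ^ 3 + 5 / 64 * a ^ 2 * cnj a)"

definition P3 :: "complex \<Rightarrow> complex \<Rightarrow> complex \<Rightarrow> real" where
  "P3 a b z =
     19568944742400 + 4892236185600 * (cmod z) ^ 2 + 611529523200 * (cmod (z ^ 2)) ^ 2
     + 50960793600 * (cmod z) ^ 6 + 398131200 * (cmod a) ^ 2
     + 2919628800 * (cmod (z ^ 4 - 1 / 22 * a * z)) ^ 2
     + 298598400 / 11 * (cmod (a * z)) ^ 2
     + 114130944 * (cmod (z ^ 5 - 25 / 172 * a * z ^ 2 - 1 / 86 * b)) ^ 2
     + 74649600 / 43 * (cmod (a * z ^ 2 - 1 / 9 * b)) ^ 2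
     + 2820096 * (cmod (z ^ 6 - 35 / 102 * a * z ^ 3 - 5 / 816 * a ^ 2 - 8 / 153 * b * z)) ^ 2
     + 230400 / 17 * (cmod (a * z ^ 3 - 7 / 16 * a ^ 2 - 1 / 3 * b * z)) ^ 2
     + 41472 * (cmod (z ^ 7 - 5 / 8 * a * z ^ 4 - 1 / 6 * b * z ^ 2)) ^ 2
     + 324 * (cmod (z ^ 8 - a * z ^ 5 - 4 / 9 * b * z ^ 3 + 1 / 36 * a * b)) ^ 2
     + (cmod (z ^ 9 - 3 / 2 * a * z ^ 6 + 5 / 64 * a ^ 3 - b * z ^ 4 + 1 / 4 * a * b * z)) ^ 2"

definition Psi3 :: "complex \<Rightarrow> complex \<Rightarrow> real \<times> real \<Rightarrow> complex" where
  "Psi3 a b = (\<lambda>(x, y). W3 a b (Complex x y) / complex_of_real (sqrt (P3 a b (Complex x y))))"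

end

theory Submission
  imports Defs
begin

text \<open>Write \<open>W\<close> and \<open>P\<close> as polynomials in independent variables \<open>z\<close> and \<open>w = cnj z\<close>, and let \<open>V\<close>
  be the conjugate of \<open>W\<close>. The sine-Gordon equation for \<open>W / sqrt P\<close> follows from the bilinear
  equation \<open>4 (P P\<^sub>z\<^sub>w - P\<^sub>z P\<^sub>w) = (P - W V)\<^sup>2\<close> and a cubic one, both of which are identities between
  polynomials in \<open>z, w, a, b\<close> and the conjugates of \<open>a\<close> and \<open>b\<close>. Since \<open>P\<close> is a sum of squared moduli
  of holomorphic polynomials, among them a constant and a multiple of \<open>z\<close>, the Cauchy-Schwarz
  inequality makes the left-hand side of the bilinear equation positive. So \<open>P - |W|\<^sup>2\<close> never
  vanishes; by continuity it is positive, which keeps the denominator \<open>2 - |\<psi>|\<^sup>2\<close> away from zero.\<close>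

section \<open>Wirtinger derivatives\<close>

text \<open>Every real-linear map of the complex plane is \<open>p * h + q * cnj h\<close> for
  unique \<open>p\<close> and \<open>q\<close>, so these are the derivatives of \<open>f\<close>
  with respect to \<open>z\<close> and \<open>cnj z\<close>.\<close>

definition has_wirtinger :: "(complex \<Rightarrow> complex) \<Rightarrow> complex \<Rightarrow> complex \<Rightarrow> complex \<Rightarrow> bool" where
  "has_wirtinger f p q z \<longleftrightarrow> (f has_derivative (\<lambda>h. p * h + q * cnj h)) (at z)"

lemma has_wirtinger_add:
  assumes "has_wirtinger f p q z" "has_wirtinger g r s z"
  shows "has_wirtinger (\<lambda>z. f z + g z) (p + r) (q + s) z"
proof -
  have "((\<lambda>z. f z + g z) has_derivative (\<lambda>h. (p * h + q * cnj h) + (r * h + s * cnj h))) (at z)"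
    using assms unfolding has_wirtinger_def by (rule has_derivative_add)
  then show ?thesis
    unfolding has_wirtinger_def by (rule has_derivative_eq_rhs) (simp add: fun_eq_iff algebra_simps)
qed

lemma has_wirtinger_mult:
  assumes "has_wirtinger f p q z" "has_wirtinger g r s z"
  shows "has_wirtinger (\<lambda>z. f z * g z) (p * g z + f z * r) (q * g z + f z * s) z"
proof -
  have "((\<lambda>z. f z * g z) has_derivative
      (\<lambda>h. f z * (r * h + s * cnj h) + (p * h + q * cnj h) * g z)) (at z)"
    using assms unfolding has_wirtinger_def by (rule has_derivative_mult)
  then show ?thesis
    unfolding has_wirtinger_def by (rule has_derivative_eq_rhs) (simp add: fun_eq_iff algebra_simps)
qed

lemma has_wirtinger_cmult:
  assumes "has_wirtinger f p q z"
  shows "has_wirtinger (\<lambda>z. c * f z) (c * p) (c * q) z"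
proof -
  have "((\<lambda>z. c * f z) has_derivative (\<lambda>h. c * (p * h + q * cnj h))) (at z)"
    using assms unfolding has_wirtinger_def by (rule has_derivative_mult_right)
  then show ?thesis
    unfolding has_wirtinger_def by (rule has_derivative_eq_rhs) (simp add: fun_eq_iff algebra_simps)
qed

lemma has_wirtinger_power:
  assumes "has_wirtinger f p q z"
  shows "has_wirtinger (\<lambda>z. f z ^ n) (of_nat n * p * f z ^ (n - 1)) (of_nat n * q * f z ^ (n - 1)) z"
proof -
  have "((\<lambda>z. f z ^ n) has_derivative (\<lambda>h. of_nat n * (p * h + q * cnj h) * f z ^ (n - 1))) (at z)"
    using assms unfolding has_wirtinger_def by (rule has_derivative_power)
  then show ?thesis
    unfolding has_wirtinger_def by (rule has_derivative_eq_rhs) (simp add: fun_eq_iff algebra_simps)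
qed

lemma has_wirtinger_holomorphic:
  assumes "(f has_field_derivative p) (at z)"
  shows "has_wirtinger f p 0 z"
  using assms by (simp add: has_wirtinger_def has_field_derivative_def)

lemma has_wirtinger_antiholomorphic:
  assumes "(f has_field_derivative q) (at (cnj z))"
  shows "has_wirtinger (\<lambda>z. f (cnj z)) 0 q z"
proof -
  have "((\<lambda>z. f (cnj z)) has_derivative (\<lambda>h. q * cnj h)) (at z)"
    by (rule has_derivative_compose[OF has_derivative_cnj[OF has_derivative_ident]
          assms[unfolded has_field_derivative_def]])
  then show ?thesis
    by (simp add: has_wirtinger_def)
qed

lemma continuous_on_has_wirtinger:
  assumes "\<And>z. has_wirtinger f (p z) (q z) z"
  shows "continuous_on UNIV f"
  using assms unfolding has_wirtinger_def
  by (intro continuous_at_imp_continuous_on ballI) (blast intro: has_derivative_continuous)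

section \<open>From Wirtinger derivatives to partial derivatives on the real plane\<close>

definition plane :: "(complex \<Rightarrow> complex) \<Rightarrow> real \<times> real \<Rightarrow> complex" where
  "plane f = (\<lambda>(x, y). f (Complex x y))"

lemma continuous_on_plane:
  assumes "continuous_on UNIV f"
  shows "continuous_on UNIV (plane f)"
proof -
  have "continuous_on UNIV (\<lambda>v::real \<times> real. Complex (fst v) (snd v))"
    by (intro continuous_intros)
  then have "continuous_on UNIV (\<lambda>v::real \<times> real. f (Complex (fst v) (snd v)))"
    by (rule continuous_on_compose2[OF assms]) simp
  then show ?thesis
    by (simp add: plane_def case_prod_beta)
qed

text \<open>The derivative is evaluated in the directions \<open>1\<close> and \<open>\<i>\<close>;
  conjugation fixes the first and negates the second.\<close>

lemma has_wirtinger_partials: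
  assumes "has_wirtinger f p q (Complex x y)"
  shows "((\<lambda>t. f (Complex t y)) has_vector_derivative (p + q)) (at x)"
    and "((\<lambda>t. f (Complex x t)) has_vector_derivative \<i> * (p - q)) (at y)"
proof -
  have D: "(f has_derivative (\<lambda>h. p * h + q * cnj h)) (at (Complex x y))"
    using assms by (simp add: has_wirtinger_def)
  have "((\<lambda>t. of_real t + \<i> * of_real y) has_derivative (\<lambda>h. of_real h)) (at x)"
    by (auto intro!: derivative_eq_intros)
  from has_derivative_compose[OF this D[unfolded Complex_eq]]
  have "((\<lambda>t. f (of_real t + \<i> * of_real y)) has_derivative
      (\<lambda>h. p * of_real h + q * cnj (of_real h))) (at x)" .
  then show "((\<lambda>t. f (Complex t y)) has_vector_derivative (p + q)) (at x)"
    by (simp add: has_vector_derivative_def Complex_eq scaleR_conv_of_real algebra_simps)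
  have "((\<lambda>t. of_real x + \<i> * of_real t) has_derivative (\<lambda>h. \<i> * of_real h)) (at y)"
    by (auto intro!: derivative_eq_intros)
  from has_derivative_compose[OF this D[unfolded Complex_eq]]
  have "((\<lambda>t. f (of_real x + \<i> * of_real t)) has_derivative
      (\<lambda>h. p * (\<i> * of_real h) + q * cnj (\<i> * of_real h))) (at y)" .
  then show "((\<lambda>t. f (Complex x t)) has_vector_derivative \<i> * (p - q)) (at y)"
    by (simp add: has_vector_derivative_def Complex_eq scaleR_conv_of_real algebra_simps)
qed

lemma
  assumes "\<And>z. has_wirtinger f (p z) (q z) z"
  shows has_partials_plane: "has_partials (plane f)"
    and partial_x_plane: "partial_x (plane f) = plane (\<lambda>z. p z + q z)"
    and partial_y_plane: "partial_y (plane f) = plane (\<lambda>z. \<i> * (p z - q z))"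
proof -
  note D = has_wirtinger_partials[OF assms]
  show "has_partials (plane f)"
    unfolding has_partials_def plane_def split_conv by (blast intro: differentiableI_vector D)
  show "partial_x (plane f) = plane (\<lambda>z. p z + q z)"
    by (simp add: fun_eq_iff partial_x_def plane_def vector_derivative_at[OF D(1)])
  show "partial_y (plane f) = plane (\<lambda>z. \<i> * (p z - q z))"
    by (simp add: fun_eq_iff partial_y_def plane_def vector_derivative_at[OF D(2)])
qed

text \<open>Since \<open>\<i>\<close> squares to -1, the sum of squares is
  \<open>(p + q)^2 - (p - q)^2\<close>.\<close>

lemma grad_sq_plane:
  assumes "\<And>z. has_wirtinger f (p z) (q z) z"
  shows "grad_sq (plane f) (x, y) = 4 * p (Complex x y) * q (Complex x y)"
  unfolding grad_sq_def partial_x_plane[OF assms] partial_y_plane[OF assms]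
  by (simp add: plane_def power2_eq_square algebra_simps)

text \<open>The shared \<open>r\<close> encodes equality of the mixed derivatives. The pure second
  derivatives \<open>pp\<close> and \<open>qq\<close> enter the two summands with opposite signs and
  cancel.\<close>

lemma laplacian_plane:
  assumes f: "\<And>z. has_wirtinger f (p z) (q z) z"
    and p: "\<And>z. has_wirtinger p (pp z) (r z) z"
    and q: "\<And>z. has_wirtinger q (r z) (qq z) z"
  shows "laplacian (plane f) (x, y) = 4 * r (Complex x y)"
proof -
  have x: "has_wirtinger (\<lambda>z. p z + q z) (pp z + r z) (r z + qq z) z" for z
    by (rule has_wirtinger_add[OF p q])
  have y: "has_wirtinger (\<lambda>z. \<i> * (p z - q z)) (\<i> * (pp z - r z)) (\<i> * (r z - qq z)) z" for z
    using has_wirtinger_cmult[OF has_wirtinger_add[OF p has_wirtinger_cmult[OF q, of "-1"]], of \<i>]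
    by simp
  show ?thesis
    unfolding laplacian_def partial_x_plane[OF f] partial_y_plane[OF f]
      partial_x_plane[OF x] partial_y_plane[OF y]
    by (simp add: plane_def algebra_simps)
qed

section \<open>Polynomials in a complex variable and its conjugate\<close>

text \<open>The list of pairs \<open>(p, q)\<close> stands for the polynomial that is the sum of the \<open>p(z) q(w)\<close>.
  Identities hold for independent \<open>z\<close> and \<open>w\<close>; the functions on the plane arise at \<open>w = cnj z\<close>.\<close>
type_synonym bipoly = "(complex poly \<times> complex poly) list"

definition beval :: "bipoly \<Rightarrow> complex \<Rightarrow> complex \<Rightarrow> complex" where
  "beval L z w = (\<Sum>(p, q)\<leftarrow>L. poly p z * poly q w)"

definition dz :: "bipoly \<Rightarrow> bipoly" where
  "dz = map (\<lambda>(p, q). (pderiv p, q))"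

definition dw :: "bipoly \<Rightarrow> bipoly" where
  "dw = map (\<lambda>(p, q). (p, pderiv q))"

definition bsmult :: "complex \<Rightarrow> bipoly \<Rightarrow> bipoly" where
  "bsmult c = map (\<lambda>(p, q). (smult c p, q))"

definition bmult :: "bipoly \<Rightarrow> bipoly \<Rightarrow> bipoly" where
  "bmult L M = concat (map (\<lambda>(p, q). map (\<lambda>(r, s). (p * r, q * s)) M) L)"

lemma beval_simps:
  "beval [] z w = 0"
  "beval ((p, q) # L) z w = poly p z * poly q w + beval L z w"
  "beval (L @ M) z w = beval L z w + beval M z w"
  "beval (bsmult c L) z w = c * beval L z w"
  "beval (dz (bsmult c L)) z w = c * beval (dz L) z w"
  "beval (dw (bsmult c L)) z w = c * beval (dw L) z w"
  "dz [] = []" "dz ((p, q) # L) = (pderiv p, q) # dz L" "dz (L @ M) = dz L @ dz M"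
  "dw [] = []" "dw ((p, q) # L) = (p, pderiv q) # dw L" "dw (L @ M) = dw L @ dw M"
  by (induction L; simp add: beval_def dz_def dw_def bsmult_def case_prod_beta pderiv_smult
      algebra_simps)+

lemma dz_dw: "dz (dw L) = dw (dz L)"
  by (simp add: dz_def dw_def case_prod_beta)

lemma beval_bmult: "beval (bmult L M) z w = beval L z w * beval M z w"
proof -
  have "beval (map (\<lambda>(r, s). (p * r, q * s)) M) z w = poly p z * poly q w * beval M z w" for p q
    by (induction M) (auto simp: beval_simps algebra_simps)
  then show ?thesis
    by (induction L) (auto simp: beval_simps bmult_def algebra_simps)
qed

text \<open>The product rule is stated after evaluation because a list of terms represents its
  polynomial in many ways.\<close>

lemma beval_dz_bmult:
  "beval (dz (bmult L M)) z w = beval (dz L) z w * beval M z w + beval L z w * beval (dz M) z w"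
proof -
  have "beval (dz (map (\<lambda>(r, s). (p * r, q * s)) M)) z w
      = poly (pderiv p) z * poly q w * beval M z w + poly p z * poly q w * beval (dz M) z w" for p q
    by (induction M) (auto simp: beval_simps pderiv_mult algebra_simps)
  then show ?thesis
    by (induction L) (auto simp: beval_simps bmult_def algebra_simps)
qed

lemma beval_dw_bmult:
  "beval (dw (bmult L M)) z w = beval (dw L) z w * beval M z w + beval L z w * beval (dw M) z w"
proof -
  have "beval (dw (map (\<lambda>(r, s). (p * r, q * s)) M)) z w
      = poly p z * poly (pderiv q) w * beval M z w + poly p z * poly q w * beval (dw M) z w" for p q
    by (induction M) (auto simp: beval_simps pderiv_mult algebra_simps)
  then show ?thesis
    by (induction L) (auto simp: beval_simps bmult_def algebra_simps)
qed

lemma has_wirtinger_beval: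
  "has_wirtinger (\<lambda>z. beval L z (cnj z)) (beval (dz L) z (cnj z)) (beval (dw L) z (cnj z)) z"
proof (induction L)
  case Nil
  then show ?case
    using has_wirtinger_holomorphic[OF DERIV_const[of 0]] by (simp add: beval_simps)
next
  case (Cons a L)
  obtain p q where a: "a = (p, q)"
    by fastforce
  show ?case
    using has_wirtinger_add[OF has_wirtinger_mult[OF
          has_wirtinger_holomorphic[OF poly_DERIV[of p]]
          has_wirtinger_antiholomorphic[OF poly_DERIV[of q]]] Cons]
    by (simp add: a beval_simps)
qed

text \<open>Both parts go through one induction, since multiplication by \<open>z\<close> mixes
  them.\<close>

lemma real_polynomial_function_poly:
  "real_polynomial_function (\<lambda>v. Re (poly p (Complex (fst v) (snd v))))
   \<and> real_polynomial_function (\<lambda>v. Im (poly p (Complex (fst v) (snd v))))"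
proof (induction p)
  case 0
  then show ?case by auto
next
  case (pCons a p)
  moreover have "real_polynomial_function (\<lambda>v::real \<times> real. fst v)"
    "real_polynomial_function (\<lambda>v::real \<times> real. snd v)"
    by (auto intro!: real_polynomial_function.intros(1) bounded_linear_fst bounded_linear_snd)
  ultimately show ?case
    by (auto simp del: pCons_eq_0_iff intro!: real_polynomial_function.intros(2-4) real_polynomial_function_diff)
qed

lemma real_polynomial_function_beval:
  "real_polynomial_function
     (\<lambda>v. Re (beval L (Complex (fst v) (snd v)) (cnj (Complex (fst v) (snd v)))))"
proof (induction L)
  case Nil
  then show ?case by (auto simp: beval_simps)
next
  case (Cons a L)
  obtain p q where a: "a = (p, q)"
    by fastforce
  \<comment> \<open>Moving the conjugation to the coefficients reduces a polynomial in
    \<open>cnj z\<close> to one in \<open>z\<close>.\<close>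
  have cnj: "poly q (cnj z) = cnj (poly (map_poly cnj q) z)" for z
    by simp
  show ?case
    using Cons.IH real_polynomial_function_poly[of p] real_polynomial_function_poly[of "map_poly cnj q"]
    by (auto simp: a beval_simps cnj simp del: poly_map_poly_cnj
        intro!: real_polynomial_function.intros(2-4) real_polynomial_function_diff real_polynomial_function_minus)
qed

section \<open>Quotients by powers of the square root of a positive polynomial\<close>

locale positive_bipoly =
  fixes M :: bipoly and P :: "complex \<Rightarrow> real"
  assumes P_pos: "P z > 0"
    and P_eq: "beval M z (cnj z) = of_real (P z)"
begin

definition g :: "complex \<Rightarrow> complex" where
  "g z = of_real (1 / sqrt (P z))"

lemma g_square: "g z ^ 2 * beval M z (cnj z) = 1"
  using P_pos[of z] by (simp add: g_def P_eq power_divide flip: of_real_power)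

lemma g_nonzero: "g z \<noteq> 0"
  using g_square[of z] by auto

text \<open>This is the chain rule for \<open>P^(-1/2)\<close>, whose derivative in \<open>P\<close>
  is \<open>- P^(-3/2) / 2\<close>.\<close>

lemma has_wirtinger_g:
  "has_wirtinger g (- (g z ^ 3 * beval (dz M) z (cnj z) / 2)) (- (g z ^ 3 * beval (dw M) z (cnj z) / 2)) z"
proof -
  let ?D = "\<lambda>h. beval (dz M) z (cnj z) * h + beval (dw M) z (cnj z) * cnj h"
  have "((\<lambda>z. complex_of_real (P z)) has_derivative ?D) (at z)"
    using has_wirtinger_beval[of M z] unfolding has_wirtinger_def P_eq .
  then have "((\<lambda>z. Re (complex_of_real (P z))) has_derivative (\<lambda>h. Re (?D h))) (at z)"
    and "((\<lambda>z. Im (complex_of_real (P z))) has_derivative (\<lambda>h. Im (?D h))) (at z)"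
    by (intro has_derivative_Re has_derivative_Im; assumption)+
  then have R: "(P has_derivative (\<lambda>h. Re (?D h))) (at z)"
    and "((\<lambda>z. 0) has_derivative (\<lambda>h. Im (?D h))) (at z)"
    by simp_all
  \<comment> \<open>\<open>P\<close> has imaginary part zero everywhere, so by uniqueness of
    derivatives \<open>?D\<close> takes only real values. This lets the real chain rule carry over
    to the complex-valued \<open>g\<close>.\<close>
  then have "(\<lambda>h. Im (?D h)) = (\<lambda>h. 0)"
    by (blast intro: has_derivative_unique has_derivative_const)
  then have real: "complex_of_real (Re (?D h)) = ?D h" for h
    by (metis complex_is_Real_iff of_real_Re)
  have "((\<lambda>z. 1 / sqrt (P z)) has_derivative
      (\<lambda>h. - ((1 / sqrt (P z)) ^ 3 / 2) * Re (?D h))) (at z)"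
    using P_pos[of z]
    by (auto intro!: derivative_eq_intros R simp: fun_eq_iff field_simps power3_eq_cube)
  then have "(g has_derivative (\<lambda>h. of_real (- ((1 / sqrt (P z)) ^ 3 / 2) * Re (?D h)))) (at z)"
    unfolding g_def by (rule has_derivative_of_real)
  then show ?thesis
    unfolding has_wirtinger_def
    by (rule has_derivative_eq_rhs) (simp only: of_real_mult real, simp add: g_def fun_eq_iff algebra_simps)
qed

text \<open>This is \<open>L / P^(n/2)\<close>. The family is closed under both Wirtinger
  derivatives, each raising \<open>n\<close> by 2.\<close>

definition quot :: "nat \<Rightarrow> bipoly \<Rightarrow> complex \<Rightarrow> complex" where
  "quot n L z = beval L z (cnj z) * g z ^ n"

definition quot_dz :: "nat \<Rightarrow> bipoly \<Rightarrow> bipoly" where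
  "quot_dz n L = bmult (dz L) M @ bsmult (- of_nat n / 2) (bmult L (dz M))"

definition quot_dw :: "nat \<Rightarrow> bipoly \<Rightarrow> bipoly" where
  "quot_dw n L = bmult (dw L) M @ bsmult (- of_nat n / 2) (bmult L (dw M))"

lemma has_wirtinger_quot:
  "has_wirtinger (quot n L) (quot (n + 2) (quot_dz n L) z) (quot (n + 2) (quot_dw n L) z) z"
proof -
  \<comment> \<open>For \<open>n = 0\<close> the truncated exponent \<open>n - 1\<close> is
    harmless, because the factor \<open>of_nat n\<close> vanishes.\<close>
  have pow: "of_nat n * (g z ^ 3 * d) * g z ^ (n - 1) = of_nat n * d * g z ^ (n + 2)" for d
    by (cases n) (simp_all add: power_add power2_eq_square power3_eq_cube)
  \<comment> \<open>Inserting \<open>g^2 * P = 1\<close> brings both terms of the product rule to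
    the power \<open>n + 2\<close>.\<close>
  have 1: "l * g z ^ n = (l * beval M z (cnj z)) * g z ^ (n + 2)" for l
    using g_square[of z] by (simp add: power_add power2_eq_square mult_ac)
  have "quot n L = (\<lambda>z. beval L z (cnj z) * g z ^ n)"
    by (simp add: quot_def fun_eq_iff)
  moreover have "l * g z ^ n + k * (of_nat n * - (g z ^ 3 * d / 2) * g z ^ (n - 1))
      = (l * beval M z (cnj z) + (- of_nat n / 2) * (k * d)) * g z ^ (n + 2)" for k l d
    using pow[of d] unfolding 1[of l] by (auto simp: algebra_simps)
  ultimately show ?thesis
    using has_wirtinger_mult[OF has_wirtinger_beval[of L z]
        has_wirtinger_power[OF has_wirtinger_g[of z], of n]]
    by (simp only: quot_def quot_dz_def quot_dw_def beval_simps beval_bmult)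
qed

lemma quot_add: "quot n L z + quot n K z = quot n (L @ K) z"
  by (simp add: quot_def beval_simps algebra_simps)

text \<open>The partial derivatives of a quotient are again quotients with another \<open>n\<close>
  and \<open>L\<close>, hence the induction with both arbitrary.\<close>

lemma Ck_plane_quot: "Ck_plane k (plane (quot n L))"
proof (induction k arbitrary: n L)
  case 0
  show ?case
    using continuous_on_plane[OF continuous_on_has_wirtinger[OF has_wirtinger_quot]] by simp
next
  case (Suc k)
  have y: "\<i> * (quot m K z - quot m N z) = quot m (bsmult \<i> (K @ bsmult (- 1) N)) z" for m K N z
    by (simp add: quot_def beval_simps algebra_simps)
  show ?case
    using continuous_on_plane[OF continuous_on_has_wirtinger[OF has_wirtinger_quot]]
      has_partials_plane[OF has_wirtinger_quot] Suc
    by (simp add: partial_x_plane[OF has_wirtinger_quot] partial_y_plane[OF has_wirtinger_quot]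
        quot_add y)
qed

lemma smooth_plane_quot: "smooth_plane (plane (quot n L))"
  by (simp add: smooth_plane_def Ck_plane_quot)

text \<open>Equality of the mixed derivatives supplies the common \<open>r\<close> for
  \<open>laplacian_plane\<close>.\<close>

lemma quot_mixed: "quot (n + 4) (quot_dz (n + 2) (quot_dw n L)) z = quot (n + 4) (quot_dw (n + 2) (quot_dz n L)) z"
  by (simp add: quot_def quot_dz_def quot_dw_def beval_simps beval_bmult beval_dz_bmult
      beval_dw_bmult dz_dw field_simps)

lemma laplacian_quot:
  "laplacian (plane (quot n L)) (x, y) = 4 * quot (n + 4) (quot_dw (n + 2) (quot_dz n L)) (Complex x y)"
proof (rule laplacian_plane)
  fix z
  have n: "n + 4 = n + 2 + 2"
    by simp
  show "has_wirtinger (quot n L) (quot (n + 2) (quot_dz n L) z) (quot (n + 2) (quot_dw n L) z) z"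
    by (rule has_wirtinger_quot)
  show "has_wirtinger (quot (n + 2) (quot_dz n L)) (quot (n + 4) (quot_dz (n + 2) (quot_dz n L)) z)
      (quot (n + 4) (quot_dw (n + 2) (quot_dz n L)) z) z"
    unfolding n by (rule has_wirtinger_quot)
  show "has_wirtinger (quot (n + 2) (quot_dw n L)) (quot (n + 4) (quot_dw (n + 2) (quot_dz n L)) z)
      (quot (n + 4) (quot_dw (n + 2) (quot_dw n L)) z) z"
    unfolding quot_mixed[symmetric] unfolding n by (rule has_wirtinger_quot)
qed

end

section \<open>The second-order equation from two polynomial identities\<close>

context positive_bipoly
begin

text \<open>With the numerator \<open>W\<close> given by \<open>L\<close>, the last two hypotheses are the bilinear equation
  \<open>P\<^sup>2 \<Delta>(ln P) = (P - |W|\<^sup>2)\<^sup>2\<close> and a cubic equation. Clearing denominators in the sine-Gordon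
  equation leaves a linear combination of the two.\<close>
lemma CSG2_equation_at_quot:
  assumes V: "\<And>z. cnj (beval L z (cnj z)) = beval V z (cnj z)"
    and bound: "\<And>z. cmod (beval L z (cnj z)) ^ 2 < 2 * P z"
    and bilinear: "\<And>z w. 4 * (beval M z w * beval (dw (dz M)) z w - beval (dz M) z w * beval (dw M) z w)
        = (beval M z w - beval L z w * beval V z w)^2"
    and cubic: "\<And>z w. 8 * (2 * beval M z w - beval L z w * beval V z w) * beval (dw (dz L)) z w
        - 8 * (beval (dz L) z w * beval (dw M) z w + beval (dw L) z w * beval (dz M) z w)
        + 4 * beval L z w * beval (dw (dz M)) z w + 8 * beval V z w * beval (dz L) z w * beval (dw L) z w
        + beval L z w * (beval M z w - beval L z w * beval V z w) = 0"
  shows "CSG2_equation_at (plane (quot 1 L)) p"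
proof -
  obtain x y where p: "p = (x, y)"
    by fastforce
  define z where "z = Complex x y"
  define w where "w = cnj z"
  define W where "W = beval L z w"
  define Vv where "Vv = beval V z w"
  define q where "q = beval M z w"
  define Wz where "Wz = beval (dz L) z w"
  define Ww where "Ww = beval (dw L) z w"
  define Wzw where "Wzw = beval (dw (dz L)) z w"
  define qz where "qz = beval (dz M) z w"
  define qw where "qw = beval (dw M) z w"
  define qzw where "qzw = beval (dw (dz M)) z w"
  define G where "G = g z"
  note defs = W_def q_def Wz_def Ww_def Wzw_def qz_def qw_def qzw_def G_def w_def
  have I1: "4 * (q * qzw - qz * qw) = (q - W * Vv)^2"
    using bilinear[of z w] by (simp add: defs Vv_def)
  have I2: "8 * (2 * q - W * Vv) * Wzw - 8 * (Wz * qw + Ww * qz) + 4 * W * qzw + 8 * Vv * Wz * Ww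
      + W * (q - W * Vv) = 0"
    using cubic[of z w] by (simp add: defs Vv_def)
  have Gq: "G^2 * q = 1"
    using g_square[of z] by (simp add: defs)
  have G0: "G \<noteq> 0"
    using g_nonzero[of z] by (simp add: defs)
  have psi: "plane (quot 1 L) p = W * G"
    by (simp add: p plane_def quot_def defs z_def)
  have "cnj W = Vv"
    using V[of z] by (simp add: defs Vv_def)
  moreover have "cnj G = G"
    by (simp add: defs g_def)
  ultimately have cnj_psi: "cnj (plane (quot 1 L) p) = Vv * G"
    by (simp only: psi complex_cnj_mult)
  have N: "of_real ((cmod (plane (quot 1 L) p))\<^sup>2) = W * Vv * G^2"
    unfolding complex_norm_square cnj_psi by (simp only: psi power2_eq_square mult_ac)
  have Q: "2 - W * Vv * G^2 = G^2 * (2 * q - W * Vv)"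
    using Gq by (simp add: algebra_simps)
  have "complex_of_real (2 * P z - cmod W ^ 2) \<noteq> 0"
    using bound[of z] by (simp del: of_real_diff add: defs)
  moreover have "complex_of_real (2 * P z - cmod W ^ 2) = 2 * q - W * Vv"
    using P_eq[of z] complex_norm_square[of W] \<open>cnj W = Vv\<close> by (simp add: q_def w_def)
  ultimately have Q0: "2 * q - W * Vv \<noteq> 0"
    by (simp only: not_False_eq_True)
  have lap: "laplacian (plane (quot 1 L)) p
      = 4 * G^5 * (Wzw * q^2 - (Wz * qw + Ww * qz + W * qzw) * q / 2 + 3 / 4 * W * qz * qw)"
    unfolding p laplacian_quot
    by (simp add: quot_def quot_dz_def quot_dw_def beval_simps beval_bmult beval_dw_bmult
        flip: z_def)
      (simp add: field_simps power2_eq_square flip: defs)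
  have grad: "grad_sq (plane (quot 1 L)) p
      = 4 * G^6 * (Wz * q - W * qz / 2) * (Ww * q - W * qw / 2)"
    unfolding p grad_sq_plane[OF has_wirtinger_quot]
    by (simp add: quot_def quot_dz_def quot_dw_def beval_simps beval_bmult flip: z_def)
      (simp add: field_simps eval_nat_numeral flip: defs)
  \<comment> \<open>The left side is the equation multiplied by
    \<open>(2 * q - W * Vv) / G^5\<close>. The right side combines the cubic equation, with
    multiplier \<open>q^2 / 2\<close>, and the bilinear one, with multiplier
    \<open>- W * (q + (q - W * Vv) / 2)\<close>; the two sides agree identically.\<close>
  have "4 * (2 * q - W * Vv) * (Wzw * q^2 - (Wz * qw + Ww * qz + W * qzw) * q / 2 + 3 / 4 * W * qz * qw)
      + 4 * Vv * (Wz * q - W * qz / 2) * (Ww * q - W * qw / 2)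
      + 1 / 2 * W * (q - W * Vv) * (2 * q - W * Vv)^2
    = q^2 / 2 * (8 * (2 * q - W * Vv) * Wzw - 8 * (Wz * qw + Ww * qz) + 4 * W * qzw
        + 8 * Vv * Wz * Ww + W * (q - W * Vv))
      - W * (q + (q - W * Vv) / 2) * (4 * (q * qzw - qz * qw) - (q - W * Vv)^2)"
    by (simp add: field_simps power2_eq_square)
  also have "\<dots> = 0"
    unfolding I1 I2 by simp
  finally have X: "4 * (2 * q - W * Vv) * (Wzw * q^2 - (Wz * qw + Ww * qz + W * qzw) * q / 2 + 3 / 4 * W * qz * qw)
      + 4 * Vv * (Wz * q - W * qz / 2) * (Ww * q - W * qw / 2)
      + 1 / 2 * W * (q - W * Vv) * (2 * q - W * Vv)^2 = 0" .
  have third: "1 / 2 * (W * G) * (1 - W * Vv * G^2) * (2 - W * Vv * G^2)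
      = G^5 * (1 / 2 * W * (q - W * Vv) * (2 * q - W * Vv))"
  proof -
    have "1 - W * Vv * G^2 = G^2 * (q - W * Vv)"
      using Gq by (simp add: algebra_simps)
    then show ?thesis
      unfolding Q by (simp add: eval_nat_numeral)
  qed
  have second: "grad_sq (plane (quot 1 L)) p * (Vv * G) / (2 - W * Vv * G^2)
      = G^5 * (4 * Vv * (Wz * q - W * qz / 2) * (Ww * q - W * qw / 2)) / (2 * q - W * Vv)"
    unfolding grad Q using G0 Q0 by (simp add: divide_simps eval_nat_numeral)
  have "laplacian (plane (quot 1 L)) p + grad_sq (plane (quot 1 L)) p * (Vv * G) / (2 - W * Vv * G^2)
      + 1 / 2 * (W * G) * (1 - W * Vv * G^2) * (2 - W * Vv * G^2)
    = G^5 / (2 * q - W * Vv) *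
      (4 * (2 * q - W * Vv) * (Wzw * q^2 - (Wz * qw + Ww * qz + W * qzw) * q / 2 + 3 / 4 * W * qz * qw)
      + 4 * Vv * (Wz * q - W * qz / 2) * (Ww * q - W * qw / 2)
      + 1 / 2 * W * (q - W * Vv) * (2 * q - W * Vv)^2)"
  proof -
    \<comment> \<open>Variables stand for the large factors, so clearing the denominator stays a
      small computation.\<close>
    have *: "4 * g5 * a + g5 * b / r + g5 * (1 / 2 * W * d * r)
        = g5 / r * (4 * r * a + b + 1 / 2 * W * d * r^2)" if "r \<noteq> 0" for g5 a b d r :: complex
      using that by (simp add: field_simps power2_eq_square)
    show ?thesis
      unfolding second third lap by (rule *[OF Q0])
  qed
  then have E: "laplacian (plane (quot 1 L)) p + grad_sq (plane (quot 1 L)) p * (Vv * G) / (2 - W * Vv * G^2)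
      + 1 / 2 * (W * G) * (1 - W * Vv * G^2) * (2 - W * Vv * G^2) = 0"
    unfolding X by simp
  have "(cmod (plane (quot 1 L) p))\<^sup>2 \<noteq> 2"
  proof
    assume "(cmod (plane (quot 1 L) p))\<^sup>2 = 2"
    then have "2 - W * Vv * G^2 = 0"
      using N by simp
    then show False
      using Q G0 Q0 by simp
  qed
  with E show ?thesis
    unfolding CSG2_equation_at_def of_real_diff N cnj_psi by (simp add: psi del: One_nat_def)
qed

end

section \<open>Gram polynomials\<close>

text \<open>The list \<open>qs\<close> is not tied to the conjugates of \<open>ps\<close>, so that
  identities can be stated with independent parameters.\<close>

definition gram :: "real list \<Rightarrow> complex poly list \<Rightarrow> complex poly list \<Rightarrow> bipoly" where
  "gram cs ps qs = map (\<lambda>(c, p, q). (smult (of_real c) p, q)) (zip cs (zip ps qs))"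

lemma Cauchy_Schwarz_sum_list:
  fixes xs :: "(real \<times> complex \<times> complex) list"
  assumes "\<forall>(c, u, v) \<in> set xs. 0 \<le> c"
  shows "cmod (\<Sum>(c, u, v)\<leftarrow>xs. of_real c * v * cnj u) ^ 2
    \<le> (\<Sum>(c, u, v)\<leftarrow>xs. c * cmod u ^ 2) * (\<Sum>(c, u, v)\<leftarrow>xs. c * cmod v ^ 2)"
  using assms
proof (induction xs)
  case Nil
  then show ?case by simp
next
  case (Cons t xs)
  obtain c u v where t: "t = (c, u, v)"
    by (cases t) auto
  define S T U where "S = (\<Sum>(c, u, v)\<leftarrow>xs. c * cmod u ^ 2)"
    and "T = (\<Sum>(c, u, v)\<leftarrow>xs. c * cmod v ^ 2)"
    and "U = (\<Sum>(c, u, v)\<leftarrow>xs. complex_of_real c * v * cnj u)"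
  have c: "0 \<le> c"
    using Cons.prems t by auto
  have "0 \<le> c" if "(c, u, v) \<in> set xs" for c u v
    using Cons.prems that by fastforce
  then have ST: "0 \<le> S" "0 \<le> T"
    unfolding S_def T_def by (auto intro!: sum_list_nonneg)
  have "cmod U ^ 2 \<le> (sqrt S * sqrt T) ^ 2"
    using Cons ST by (simp add: S_def T_def U_def power_mult_distrib)
  then have "cmod U \<le> sqrt S * sqrt T"
    by (rule power2_le_imp_le) (simp add: ST)
  moreover have "cmod (of_real c * v * cnj u) = (sqrt c * cmod u) * (sqrt c * cmod v)"
    using c by (simp add: norm_mult algebra_simps)
  ultimately have "cmod (of_real c * v * cnj u + U)
      \<le> (sqrt c * cmod u) * (sqrt c * cmod v) + sqrt S * sqrt T"
    using norm_triangle_ineq[of "of_real c * v * cnj u" U] by simp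
  then have "cmod (of_real c * v * cnj u + U) ^ 2
      \<le> ((sqrt c * cmod u) * (sqrt c * cmod v) + sqrt S * sqrt T) ^ 2"
    by (rule power_mono) simp
  \<comment> \<open>Lagrange's identity in two dimensions; dropping the subtracted square joins the
    new term to the inductive bound.\<close>
  also have "\<dots> = ((sqrt c * cmod u) ^ 2 + sqrt S ^ 2) * ((sqrt c * cmod v) ^ 2 + sqrt T ^ 2)
      - (sqrt c * cmod u * sqrt T - sqrt c * cmod v * sqrt S) ^ 2"
    by algebra
  also have "\<dots> \<le> (c * cmod u ^ 2 + S) * (c * cmod v ^ 2 + T)"
    using c ST by (simp add: power_mult_distrib)
  finally show ?case
    by (simp add: t S_def T_def U_def)
qed

text \<open>At \<open>w = cnj z\<close> this is the sum of the \<open>c |p(z)|\<^sup>2\<close>.\<close>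
abbreviation hermitian_gram :: "real list \<Rightarrow> complex poly list \<Rightarrow> bipoly" where
  "hermitian_gram cs ps \<equiv> gram cs ps (map (map_poly cnj) ps)"

lemma pderiv_map_poly_cnj: "pderiv (map_poly cnj p) = map_poly cnj (pderiv p)"
  by (rule poly_eqI) (simp add: coeff_pderiv coeff_map_poly)

lemma gram_simps:
  "gram [] ps qs = []"
  "gram cs [] qs = []"
  "gram (c # cs) (p # ps) (q # qs) = (smult (of_real c) p, q) # gram cs ps qs"
  by (simp_all add: gram_def)

lemma beval_hermitian_gram:
  "beval (hermitian_gram cs ps) z (cnj z)
    = of_real (\<Sum>(c, p)\<leftarrow>zip cs ps. c * cmod (poly p z) ^ 2)" (is ?P)
  "beval (dz (hermitian_gram cs ps)) z (cnj z)
    = (\<Sum>(c, p)\<leftarrow>zip cs ps. of_real c * poly (pderiv p) z * cnj (poly p z))" (is ?Pz)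
  "beval (dw (hermitian_gram cs ps)) z (cnj z)
    = cnj (\<Sum>(c, p)\<leftarrow>zip cs ps. of_real c * poly (pderiv p) z * cnj (poly p z))" (is ?Pw)
  "beval (dw (dz (hermitian_gram cs ps))) z (cnj z)
    = of_real (\<Sum>(c, p)\<leftarrow>zip cs ps. c * cmod (poly (pderiv p) z) ^ 2)" (is ?Pzw)
proof -
  have "?P \<and> ?Pz \<and> ?Pw \<and> ?Pzw"
  proof (induction cs arbitrary: ps)
    case Nil
    then show ?case by (simp add: gram_simps beval_simps)
  next
    case (Cons c cs)
    show ?case
    proof (cases ps)
      case Nil
      then show ?thesis by (simp add: gram_simps beval_simps)
    next
      case (Cons p ps')
      then show ?thesis
        using Cons.IH[of ps']
        by (simp add: gram_simps beval_simps pderiv_smult pderiv_map_poly_cnj mult.assoc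
            flip: complex_norm_square)
    qed
  qed
  then show ?P ?Pz ?Pw ?Pzw
    by blast+
qed

text \<open>The constant entry adds \<open>c\<close> to the polynomial and nothing to its
  derivatives. With \<open>S\<close>, \<open>T\<close>, \<open>U\<close> summed over the other
  entries, the expression is \<open>c * T + (S * T - |U|^2)\<close>; Cauchy-Schwarz handles the
  bracket, and the entry \<open>z\<close> gives \<open>T \<ge> d > 0\<close>.\<close>

lemma hermitian_gram_hessian_pos:
  fixes ps :: "complex poly list"
  assumes "0 < c" "0 < d" "\<forall>e \<in> set cs. 0 \<le> e"
  defines "M \<equiv> hermitian_gram (c # d # cs) ([:1:] # [:0, 1:] # ps)"
  shows "0 < Re (beval M z (cnj z) * beval (dw (dz M)) z (cnj z)
    - beval (dz M) z (cnj z) * beval (dw M) z (cnj z))"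
proof -
  define es where "es = (d, [:0, 1:]) # zip cs ps"
  define S T U where "S = (\<Sum>(c, p)\<leftarrow>es. c * cmod (poly p z) ^ 2)"
    and "T = (\<Sum>(c, p)\<leftarrow>es. c * cmod (poly (pderiv p) z) ^ 2)"
    and "U = (\<Sum>(c, p)\<leftarrow>es. complex_of_real c * poly (pderiv p) z * cnj (poly p z))"
  have nonneg: "0 \<le> e" if "(e, p) \<in> set es" for e p
    using that assms(2,3) by (auto simp: es_def dest: set_zip_leftD)
  have "cmod U ^ 2 \<le> S * T"
    using Cauchy_Schwarz_sum_list[of "map (\<lambda>(c, p). (c, poly p z, poly (pderiv p) z)) es"] nonneg
    by (force simp: S_def T_def U_def o_def case_prod_unfold)
  moreover have "0 < T"
  proof -
    have "0 \<le> e" if "(e, p) \<in> set (zip cs ps)" for e p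
      using nonneg[of e p] that by (simp add: es_def)
    then have "0 \<le> (\<Sum>(c, p)\<leftarrow>zip cs ps. c * cmod (poly (pderiv p) z) ^ 2)"
      by (auto intro!: sum_list_nonneg)
    then show ?thesis
      using assms(2) by (simp add: T_def es_def pderiv_pCons)
  qed
  ultimately have "cmod U ^ 2 < (c + S) * T"
    using mult_pos_pos[OF assms(1), of T] by (simp add: distrib_right)
  moreover have "beval M z (cnj z) = of_real (c + S)" "beval (dw (dz M)) z (cnj z) = of_real T"
    "beval (dz M) z (cnj z) = U" "beval (dw M) z (cnj z) = cnj U"
    unfolding M_def beval_hermitian_gram by (simp_all add: S_def T_def U_def es_def pderiv_pCons)
  then have "beval M z (cnj z) * beval (dw (dz M)) z (cnj z)
      - beval (dz M) z (cnj z) * beval (dw M) z (cnj z) = of_real ((c + S) * T - cmod U ^ 2)"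
    by (simp only: of_real_diff of_real_mult complex_norm_square)
  ultimately show ?thesis
    by simp
qed

section \<open>The three-vortex family\<close>

definition wts :: "real list" where
  "wts = [19568944742400, 4892236185600, 611529523200, 50960793600, 398131200, 2919628800, 298598400 / 11,
          114130944, 74649600 / 43, 2820096, 230400 / 17, 41472, 324, 1]"

text \<open>The entries follow the summands of \<open>P3\<close>, with \<open>z^3\<close> accounting
  for \<open>|z|^6\<close>. The entries \<open>1\<close> and \<open>z\<close> lead, as
  \<open>hermitian_gram_hessian_pos\<close> requires.\<close>

definition hol_polys :: "complex \<Rightarrow> complex \<Rightarrow> complex poly list" where
  "hol_polys a b =
    [[:1:], [:0, 1:], [:0, 0, 1:], [:0, 0, 0, 1:], [:a:],
     [:0, - a / 22, 0, 0, 1:], [:0, a:],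
     [:- b / 86, 0, - 25 * a / 172, 0, 0, 1:], [:- b / 9, 0, a:],
     [:- 5 * a^2 / 816, - 8 * b / 153, 0, - 35 * a / 102, 0, 0, 1:], [:- 7 * a^2 / 16, - b / 3, 0, a:],
     [:0, 0, - b / 6, 0, - 5 * a / 8, 0, 0, 1:],
     [:a * b / 36, 0, 0, - 4 * b / 9, 0, - a, 0, 0, 1:],
     [:5 * a^3 / 64, a * b / 4, 0, 0, - b, 0, - 3 * a / 2, 0, 0, 1:]]"

abbreviation P_bi :: "complex \<Rightarrow> complex \<Rightarrow> complex \<Rightarrow> complex \<Rightarrow> bipoly" where
  "P_bi a A b B \<equiv> gram wts (hol_polys a b) (hol_polys A B)"

text \<open>The terms of \<open>W\<close> sorted by powers of \<open>cnj z\<close>; the argument \<open>A\<close> stands for \<open>cnj a\<close>.\<close>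
definition W_bi :: "complex \<Rightarrow> complex \<Rightarrow> complex \<Rightarrow> bipoly" where
  "W_bi a A b =
    [([:11520 * a + 5 * a^2 * A / 64, A * b / 4, 0, 92160 + 5 * a * A / 16, 0, 0, - A / 4:], [:1:]),
     ([:0, - 1440 * a, 0, 0, 5760:], [:0, 1:]),
     ([:- 24 * b, 0, - 90 * a, 0, 0, 144:], [:0, 0, 1:]),
     ([:- 5 * a^2 / 16, - b, 0, - 5 * a / 4, 0, 0, 1:], [:0, 0, 0, 1:])]"

text \<open>Exchanging \<open>z\<close> and \<open>w\<close> and conjugating the parameters turns
  \<open>W\<close> into its conjugate on \<open>w = cnj z\<close>.\<close>

abbreviation bswap :: "bipoly \<Rightarrow> bipoly" where
  "bswap \<equiv> map (\<lambda>(p, q). (q, p))"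

lemma beval_bswap: "beval (bswap L) z w = beval L w z"
  by (induction L) (auto simp: beval_simps)

lemma map_hol_polys_cnj: "map (map_poly cnj) (hol_polys a b) = hol_polys (cnj a) (cnj b)"
  by (simp add: hol_polys_def map_poly_pCons)

lemma beval_W_bi: "beval (W_bi a (cnj a) b) z (cnj z) = W3 a b z"
  unfolding W3_def F3_def Let_def
  by (simp add: W_bi_def beval_simps) algebra

text \<open>The numerical coefficients are real, so conjugation acts only on parameters and
  variables.\<close>

lemma cnj_W_bi: "cnj (beval (W_bi a A b) z w) = beval (W_bi (cnj a) (cnj A) (cnj b)) (cnj z) (cnj w)"
  by (simp add: W_bi_def beval_simps)

lemma beval_P_bi: "beval (P_bi a (cnj a) b (cnj b)) z (cnj z) = of_real (P3 a b z)"
proof -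
  have polys: "map (\<lambda>p. poly p z) (hol_polys a b) =
    [1, z, z ^ 2, z ^ 3, a, z ^ 4 - 1 / 22 * a * z, a * z, z ^ 5 - 25 / 172 * a * z ^ 2 - 1 / 86 * b,
     a * z ^ 2 - 1 / 9 * b, z ^ 6 - 35 / 102 * a * z ^ 3 - 5 / 816 * a ^ 2 - 8 / 153 * b * z,
     a * z ^ 3 - 7 / 16 * a ^ 2 - 1 / 3 * b * z, z ^ 7 - 5 / 8 * a * z ^ 4 - 1 / 6 * b * z ^ 2,
     z ^ 8 - a * z ^ 5 - 4 / 9 * b * z ^ 3 + 1 / 36 * a * b,
     z ^ 9 - 3 / 2 * a * z ^ 6 + 5 / 64 * a ^ 3 - b * z ^ 4 + 1 / 4 * a * b * z]"
    by (simp add: hol_polys_def algebra_simps eval_nat_numeral)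
  have "(\<Sum>(c, p)\<leftarrow>zip wts (hol_polys a b). c * cmod (poly p z) ^ 2)
      = (\<Sum>(c, u)\<leftarrow>zip wts (map (\<lambda>p. poly p z) (hol_polys a b)). c * cmod u ^ 2)"
    by (simp add: zip_map2 o_def case_prod_unfold)
  also have "\<dots> = P3 a b z"
  proof -
    have "cmod (z ^ 3) ^ 2 = cmod z ^ 6"
      by (simp add: norm_power flip: power_mult)
    then show ?thesis
      unfolding polys by (simp add: wts_def P3_def)
  qed
  finally show ?thesis
    using beval_hermitian_gram(1)[of wts "hol_polys a b" z] by (simp add: map_hol_polys_cnj)
qed

text \<open>A polynomial identity in six independent variables, checked by expansion;
  \<open>A\<close>, \<open>B\<close>, \<open>w\<close> need not be conjugates.\<close>

lemma P3_bilinear: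
  "4 * (beval (P_bi a A b B) z w * beval (dw (dz (P_bi a A b B))) z w
    - beval (dz (P_bi a A b B)) z w * beval (dw (P_bi a A b B)) z w)
   = (beval (P_bi a A b B) z w - beval (W_bi a A b) z w * beval (W_bi A a B) w z)^2"
proof -
  \<comment> \<open>With \<open>a = 4 c\<close> all coefficients of the expanded polynomials are integers.\<close>
  obtain c C where a: "a = 4 * c" "A = 4 * C"
    by (metis nonzero_mult_div_cancel_left times_divide_eq_right zero_neq_numeral)
  show ?thesis
    unfolding a
    by (simp add: beval_def dz_def dw_def gram_def wts_def hol_polys_def W_bi_def pderiv_pCons) algebra
qed

lemma W3_cubic:
  "8 * (2 * beval (P_bi a A b B) z w - beval (W_bi a A b) z w * beval (W_bi A a B) w z)
      * beval (dw (dz (W_bi a A b))) z w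
    - 8 * (beval (dz (W_bi a A b)) z w * beval (dw (P_bi a A b B)) z w
      + beval (dw (W_bi a A b)) z w * beval (dz (P_bi a A b B)) z w)
    + 4 * beval (W_bi a A b) z w * beval (dw (dz (P_bi a A b B))) z w
    + 8 * beval (W_bi A a B) w z * beval (dz (W_bi a A b)) z w * beval (dw (W_bi a A b)) z w
    + beval (W_bi a A b) z w
      * (beval (P_bi a A b B) z w - beval (W_bi a A b) z w * beval (W_bi A a B) w z) = 0"
proof -
  \<comment> \<open>The same substitution as in the bilinear identity clears the
    denominators.\<close>
  obtain c C where a: "a = 4 * c" "A = 4 * C"
    by (metis nonzero_mult_div_cancel_left times_divide_eq_right zero_neq_numeral)
  show ?thesis
    unfolding a
    by (simp add: beval_def dz_def dw_def gram_def wts_def hol_polys_def W_bi_def pderiv_pCons) algebra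
qed

section \<open>Positivity of \<open>P\<close> and of \<open>P - |W|^2\<close>\<close>

lemma P3_pos: "0 < P3 a b z"
  unfolding P3_def by (intro add_pos_nonneg) simp_all

lemma P3_neq_W3: "P3 a b z \<noteq> cmod (W3 a b z) ^ 2"
proof
  assume "P3 a b z = cmod (W3 a b z) ^ 2"
  then have "complex_of_real (P3 a b z) = W3 a b z * cnj (W3 a b z)"
    by (simp only: complex_norm_square)
  then have "beval (P_bi a (cnj a) b (cnj b)) z (cnj z)
      = beval (W_bi a (cnj a) b) z (cnj z) * beval (W_bi (cnj a) a (cnj b)) (cnj z) z"
    using cnj_W_bi[of a "cnj a" b z "cnj z"] by (simp add: beval_P_bi beval_W_bi)
  then have "beval (P_bi a (cnj a) b (cnj b)) z (cnj z) * beval (dw (dz (P_bi a (cnj a) b (cnj b)))) z (cnj z)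
      - beval (dz (P_bi a (cnj a) b (cnj b))) z (cnj z) * beval (dw (P_bi a (cnj a) b (cnj b))) z (cnj z) = 0"
    using P3_bilinear[of a b "cnj a" "cnj b" z "cnj z"] by simp
  \<comment> \<open>Splitting off the entries \<open>1\<close> and \<open>z\<close> exposes the
    shape for which the left side of the bilinear identity is positive.\<close>
  moreover have "P_bi a (cnj a) b (cnj b) = hermitian_gram (hd wts # hd (tl wts) # tl (tl wts))
      ([:1:] # [:0, 1:] # tl (tl (hol_polys a b)))"
    unfolding map_hol_polys_cnj[symmetric] by (simp add: wts_def hol_polys_def)
  moreover have "0 < hd wts" "0 < hd (tl wts)" "\<forall>e \<in> set (tl (tl wts)). 0 \<le> e"
    by (simp_all add: wts_def)
  ultimately show False
    using hermitian_gram_hessian_pos[of "hd wts" "hd (tl wts)" "tl (tl wts)" "tl (tl (hol_polys a b))" z]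
    by simp
qed

text \<open>Scaling \<open>a\<close>, \<open>b\<close>, \<open>z\<close> to zero connects every point to one where the inequality is evident,
  and equality cannot occur on the way.\<close>
lemma W3_less_P3: "cmod (W3 a b z) ^ 2 < P3 a b z"
proof (rule ccontr)
  assume not_less: "\<not> cmod (W3 a b z) ^ 2 < P3 a b z"
  \<comment> \<open>The parameters are scaled together with \<open>z\<close>, because at
    \<open>z = 0\<close> alone \<open>W3\<close> still equals
    \<open>11520 * a + 5/64 * a^2 * cnj a\<close>.\<close>
  define D where "D t = P3 (of_real t * a) (of_real t * b) (of_real t * z)
      - cmod (W3 (of_real t * a) (of_real t * b) (of_real t * z)) ^ 2" for t :: real
  have "continuous_on {0..1} D"
    unfolding D_def P3_def W3_def F3_def Let_def by (intro continuous_intros)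
  \<comment> \<open>At \<open>t = 0\<close> the value of \<open>W3\<close> is 0 and only the
    positive constant term of \<open>P3\<close> remains.\<close>
  moreover have "D 1 \<le> 0" "0 \<le> D 0"
    using not_less by (simp_all add: D_def P3_def W3_def F3_def)
  ultimately obtain t where "D t = 0"
    using IVT2'[of D 1 0 0] by auto
  then show False
    by (simp add: D_def P3_neq_W3)
qed

theorem theorem4:
  fixes a b :: complex
  shows "real_polynomial_function (\<lambda>(x, y). P3 a b (Complex x y))
    \<and> (\<forall>x y. P3 a b (Complex x y) > 0)
    \<and> smooth_CSG2_solution (Psi3 a b)"
proof (intro conjI allI)
  \<comment> \<open>\<open>P_bi\<close> is real on \<open>w = cnj z\<close>, so \<open>P3\<close> is
    its real part there.\<close>
  have "(\<lambda>(x, y). P3 a b (Complex x y)) = (\<lambda>v. Re (beval (P_bi a (cnj a) b (cnj b))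
      (Complex (fst v) (snd v)) (cnj (Complex (fst v) (snd v)))))"
    unfolding beval_P_bi by (simp add: case_prod_unfold)
  then show "real_polynomial_function (\<lambda>(x, y). P3 a b (Complex x y))"
    by (simp only: real_polynomial_function_beval)
  show "P3 a b (Complex x y) > 0" for x y
    by (rule P3_pos)
  interpret positive_bipoly "P_bi a (cnj a) b (cnj b)" "P3 a b"
    by unfold_locales (simp_all only: P3_pos beval_P_bi)
  have Psi: "Psi3 a b = plane (quot 1 (W_bi a (cnj a) b))"
    unfolding Psi3_def plane_def quot_def g_def beval_W_bi by (simp add: divide_inverse)
  have "CSG2_equation_at (Psi3 a b) p" for p
    unfolding Psi
  proof (rule CSG2_equation_at_quot[where V = "bswap (W_bi (cnj a) a (cnj b))"])
    show "cnj (beval (W_bi a (cnj a) b) z (cnj z)) = beval (bswap (W_bi (cnj a) a (cnj b))) z (cnj z)" for z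
      by (simp add: cnj_W_bi beval_bswap)
    show "cmod (beval (W_bi a (cnj a) b) z (cnj z)) ^ 2 < 2 * P3 a b z" for z
      using W3_less_P3[of a b z] P3_pos[of a b z] by (simp add: beval_W_bi)
  qed (simp_all only: beval_bswap P3_bilinear W3_cubic)
  then show "smooth_CSG2_solution (Psi3 a b)"
    by (simp add: smooth_CSG2_solution_def Psi smooth_plane_quot)
qed

end
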